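(* For any integers $n,m\ge 1$ and $k,j\ge 0$ (with $n=2m+kj$), $$\sum_{P\in\mathfrak{P}_{n,k}^{m,j}}\prod_{i\geq1}t_i^{\alpha_i(P)}=\frac{1}{m+1}\binom{m+j}{m}\sum_{r=0}^{m}\binom{m+j+1}{r}\frac{r!}{m!}\,\mathbf{B}_{m,r}\big(1!\,t_1,2!\,t_2,\dots\big).$$
   Context: For a given integer $k\ge 0$, a $k$-path (or $k$-generalized Dyck path) of length $n$ is a lattice path from $(0,0)$ to $(n,0)$ in $\mathbb{Z}\times\mathbb{Z}$ consisting of horizontal-steps $h=(k,0)$, up-steps $u=(1,1)$ and down-steps $d=(1,-1)$, which never passes below the $x$-axis. In this terminology a Dyck path is a $0$-path, a Motzkin path is a $1$-path and a Schröder path is a $2$-path; the case $k=0$ implies $j=0$ (no horizontal-steps). $\mathfrak{P}_{n,k}^{m,j}$ is the set of $k$-paths of length $n$ with $m$ up-steps and $j$ horizontal-steps (so $n=2m+kj$). A $u$-segment of a path is a maximal sequence of consecutive up-steps, and $\alpha_i(P)$ is the number of $u$-segments of length $i$ in $P$. The $t_1,t_2,\dots$ are indeterminates. $\mathbf{B}_{m,r}(x_1,x_2,\dots)$ is the partial Bell polynomial $\sum \frac{m!}{r_1!r_2!\cdots r_m!}\left(\frac{x_1}{1!}\right)^{r_1}\cdots\left(\frac{x_m}{m!}\right)^{r_m}$, the sum being over all nonnegative integer solutions of $r_1+\cdots+r_m=r$ and $r_1+2r_2+\cdots+mr_m=m$. *)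

theory Defs
  imports Main "HOL.Rat" "HOL-Library.Poly_Mapping" "HOL-Library.Product_Plus"
begin

text \<open>Polynomials over the rationals in the indeterminates \<open>t\<^sub>0, t\<^sub>1, t\<^sub>2, \<dots>\<close>: finitely supported
  maps from exponent vectors to coefficients.\<close>

type_synonym qpoly = "(nat \<Rightarrow>\<^sub>0 nat) \<Rightarrow>\<^sub>0 rat"

definition const :: "rat \<Rightarrow> qpoly" where
  "const c = Poly_Mapping.single 0 c"

definition t :: "nat \<Rightarrow> qpoly" where
  "t i = Poly_Mapping.single (Poly_Mapping.single i 1) 1"


datatype step = H | U | D

primrec step_vec :: "nat \<Rightarrow> step \<Rightarrow> int \<times> int" where
  "step_vec k H = (int k, 0)"
| "step_vec k U = (1, 1)"
| "step_vec k D = (1, -1)"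

text \<open>The point reached from the origin by a sequence of steps.\<close>

definition endpoint :: "nat \<Rightarrow> step list \<Rightarrow> int \<times> int" where
  "endpoint k P = sum_list (map (step_vec k) P)"

text \<open>The last conjunct is the convention that a \<open>0\<close>-path has no horizontal steps (they would be
  null vectors), so that the \<open>0\<close>-paths are exactly the Dyck paths.\<close>

definition is_kpath :: "nat \<Rightarrow> nat \<Rightarrow> step list \<Rightarrow> bool" where
  "is_kpath k n P \<longleftrightarrow>
     endpoint k P = (int n, 0) \<and>
     (\<forall>l\<le>length P. 0 \<le> snd (endpoint k (take l P))) \<and>
     (k = 0 \<longrightarrow> H \<notin> set P)"

definition kpaths :: "nat \<Rightarrow> nat \<Rightarrow> nat \<Rightarrow> nat \<Rightarrow> step list set" where
  "kpaths n k m j = {P. is_kpath k n P \<and> count_list P U = m \<and> count_list P H = j}"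

text \<open>The steps of \<open>P\<close> at positions \<open>a, \<dots>, a + i - 1\<close> (counted from \<open>0\<close>) form a maximal
  nonempty run of up-steps.\<close>

definition u_segment_at :: "step list \<Rightarrow> nat \<Rightarrow> nat \<Rightarrow> bool" where
  "u_segment_at P a i \<longleftrightarrow>
     1 \<le> i \<and> a + i \<le> length P \<and>
     (\<forall>l\<in>{a..<a + i}. P ! l = U) \<and>
     (a = 0 \<or> P ! (a - 1) \<noteq> U) \<and>
     (a + i = length P \<or> P ! (a + i) \<noteq> U)"

definition alpha :: "nat \<Rightarrow> step list \<Rightarrow> nat" where
  "alpha i P = card {a. u_segment_at P a i}"

text \<open>The product over all \<open>i \<ge> 1\<close> is cut off at \<open>length P\<close>, beyond which \<open>alpha i P = 0\<close>.\<close>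

definition u_weight :: "step list \<Rightarrow> qpoly" where
  "u_weight P = (\<Prod>i = 1..length P. t i ^ alpha i P)"


text \<open>The solutions \<open>(r\<^sub>1, \<dots>, r\<^sub>m)\<close>, extended by \<open>0\<close> outside \<open>{1..m}\<close>.\<close>

definition bell_solutions :: "nat \<Rightarrow> nat \<Rightarrow> (nat \<Rightarrow> nat) set" where
  "bell_solutions m r =
     {\<rho>. (\<forall>i. i \<notin> {1..m} \<longrightarrow> \<rho> i = 0) \<and> (\<Sum>i = 1..m. \<rho> i) = r \<and> (\<Sum>i = 1..m. i * \<rho> i) = m}"

definition bell_partial :: "nat \<Rightarrow> nat \<Rightarrow> (nat \<Rightarrow> qpoly) \<Rightarrow> qpoly" where
  "bell_partial m r x =
     (\<Sum>\<rho>\<in>bell_solutions m r.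
        const (fact m / (\<Prod>i = 1..m. fact (\<rho> i))) *
        (\<Prod>i = 1..m. (const (1 / fact i) * x i) ^ \<rho> i))"


lemma alpha_eq_0: "alpha i P = 0" if "length P < i"
proof -
  have "{a. u_segment_at P a i} = {}"
    using that by (auto simp: u_segment_at_def)
  then show ?thesis by (simp add: alpha_def)
qed

lemma finite_kpaths: "finite (kpaths n k m j)"
proof -
  have len: "length P = count_list P U + count_list P D + count_list P H" for P
  proof (induction P)
    case (Cons s P)
    then show ?case by (cases s) auto
  qed simp
  have ht: "snd (endpoint k P) = int (count_list P U) - int (count_list P D)" for P
  proof (induction P)
    case (Cons s P)
    then show ?case by (cases s) (auto simp: endpoint_def)
  qed (simp add: endpoint_def)
  have "length P = 2 * m + j" if "P \<in> kpaths n k m j" for P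
    using that len[of P] ht[of P] by (auto simp: kpaths_def is_kpath_def)
  then have "kpaths n k m j \<subseteq> {P. set P \<subseteq> {H, U, D} \<and> length P = 2 * m + j}"
    by (auto intro: step.exhaust)
  then show ?thesis
    using finite_lists_length_eq[of "{H, U, D}"] by (blast intro: finite_subset)
qed

lemma finite_bell_solutions: "finite (bell_solutions m r)"
proof -
  have "\<rho> i \<le> r" if "\<rho> \<in> bell_solutions m r" "i \<in> {1..m}" for \<rho> i
    using that member_le_sum[of i "{1..m}" \<rho>] by (auto simp: bell_solutions_def)
  then have "bell_solutions m r \<subseteq>
      {\<rho>. \<forall>i. (i \<in> {1..m} \<longrightarrow> \<rho> i \<in> {..r}) \<and> (i \<notin> {1..m} \<longrightarrow> \<rho> i = 0)}"
    by (auto simp: bell_solutions_def)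
  then show ?thesis
    using finite_set_of_finite_funs[of "{1..m}" "{..r}" 0] by (auto intro: finite_subset)
qed

end

theory Submission imports Defs "HOL-Combinatorics.Multiset_Permutations" begin

text \<open>Append a down-step to a path and cut the result after every step other than \<open>U\<close>. This gives
  \<open>m + j + 1\<close> blocks \<open>U\<^sup>a D\<close> or \<open>U\<^sup>a H\<close>, of which \<open>m + 1\<close> end in \<open>D\<close>, with total rise \<open>-1\<close>; the path
  stays above the axis iff every proper prefix of the sequence of rises has a nonnegative sum. By the
  cycle lemma exactly one of the \<open>m + j + 1\<close> rotations of an arbitrary such sequence has this property,
  and rotations preserve the weight. Without the positivity condition the choice of the last
  steps of the blocks and the composition \<open>(a\<^sub>0, \<dots>, a\<^sub>m\<^sub>+\<^sub>j)\<close> of \<open>m\<close> are independent; the former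
  contributes a binomial coefficient, and the latter the Bell polynomials, by grouping the
  compositions according to the multiplicities of their parts.\<close>

section \<open>The cycle lemma and its weighted form\<close>

definition proper_prefixes_nonneg :: "int list \<Rightarrow> bool" where
  "proper_prefixes_nonneg xs \<longleftrightarrow> (\<forall>l<length xs. 0 \<le> sum_list (take l xs))"

text \<open>The good rotation starts where the partial sums \<open>S\<close> first reach their
  minimum over one period. Later sums of the period are at least as large; sums met after wrapping
  round have dropped by one, but were larger by at least one before.\<close>

lemma cycle_lemma:
  assumes sum: "sum_list xs = -1"
  shows "\<exists>!r. r < length xs \<and> proper_prefixes_nonneg (rotate r xs)"
proof -
  define L where "L = length xs"
  \<comment> \<open>Partial sums of the periodic extension of \<open>xs\<close>, so that prefix sums
    of every rotation are differences of values of \<open>S\<close>.\<close>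
  define S where "S i = (\<Sum>q<i. xs ! (q mod L))" for i
  \<comment> \<open>\<open>f\<close> has period \<open>L\<close> and is injective on a period, and a rotation is good iff it starts at the minimum.\<close>
  define f where "f i = int L * S i + int i" for i
  have L: "L > 0" using sum by (auto simp: L_def)
  have "S L = -1"
    using sum by (simp add: S_def L_def sum_list_sum_nth atLeast0LessThan)
  then have S_shift: "S (i + L) = S i - 1" for i
    by (induction i) (auto simp: S_def)
  have f_shift: "f (i + L) = f i" for i
    unfolding f_def S_shift by (simp add: algebra_simps)
  have f_shift': "f (i + L * q) = f i" for i q
  proof (induction q)
    case (Suc q)
    then show ?case using f_shift [of "i + L * q"] by (simp add: ac_simps)
  qed simp
  have f_mod: "f (i mod L) = f i" for i
    using f_shift' [of "i mod L" "i div L"] by simp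
  \<comment> \<open>The summand \<open>int i\<close> breaks ties between equal partial sums in
    favour of the earlier position; the residue modulo \<open>L\<close> recovers that
    position.\<close>
  have "f i mod int L = int i mod int L" for i
    by (simp add: f_def)
  then have f_inj: "i = j" if "f i = f j" "i < L" "j < L" for i j
    using that by (metis mod_less of_nat_eq_iff zmod_int)
  have prefix: "sum_list (take l (rotate r xs)) = S (r + l) - S r" if "l \<le> L" for l r
    using that by (induction l) (auto simp: take_Suc_conv_app_nth nth_rotate L_def S_def)
  have least: "proper_prefixes_nonneg (rotate r xs) \<longleftrightarrow> (\<forall>i<L. f r \<le> f i)" if r: "r < L" for r
  proof
    assume A: "proper_prefixes_nonneg (rotate r xs)"
    show "\<forall>i<L. f r \<le> f i"
    proof (intro allI impI)
      fix i assume i: "i < L"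
      define l where "l = (i + L - r) mod L"
      have "l < L" using L by (simp add: l_def)
      then have "S r \<le> S (r + l)"
        using A prefix [of l r] by (auto simp: proper_prefixes_nonneg_def L_def)
      then have "int L * S r \<le> int L * S (r + l)"
        by (simp add: mult_left_mono)
      moreover have "(r + l) mod L = i"
        using r i by (simp add: l_def mod_simps)
      then have "f (r + l) = f i" using f_mod by metis
      ultimately show "f r \<le> f i" by (simp add: f_def)
    qed
  next
    assume A: "\<forall>i<L. f r \<le> f i"
    have "S r \<le> S (r + l)" if l: "l < L" for l
    proof -
      have "f r \<le> f (r + l)" using A f_mod [of "r + l"] L by (metis mod_less_divisor)
      \<comment> \<open>The tie-breaking terms differ by less than \<open>L\<close>, so the integer
        \<open>S r - S (r + l)\<close> is less than 1 and hence not positive.\<close>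
      then have "int L * (S r - S (r + l)) \<le> int l" by (simp add: f_def algebra_simps)
      also have "\<dots> < int L * 1" using l by simp
      finally have "S r - S (r + l) < 1" by (simp only: mult_less_cancel_left_pos L of_nat_0_less_iff)
      then show ?thesis by simp
    qed
    then show "proper_prefixes_nonneg (rotate r xs)"
      using prefix by (auto simp: proper_prefixes_nonneg_def L_def)
  qed
  have "Min (f ` {..<L}) \<in> f ` {..<L}" using L by (intro Min_in) auto
  then obtain r where "r < L" and "f r = Min (f ` {..<L})" by auto
  then have "r < L" "\<forall>i<L. f r \<le> f i" by auto
  then show ?thesis
    unfolding L_def [symmetric] using least f_inj by (metis order_antisym)
qed

text \<open>Double counting of the pairs \<open>(b, r)\<close> for which \<open>rotate r b\<close>
  is good: each \<open>b\<close> admits exactly one \<open>r\<close>, and each \<open>r\<close>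
  permutes \<open>B\<close>.\<close>

lemma sum_cycle_lemma:
  fixes w :: "'a list \<Rightarrow> 'b::comm_semiring_1"
  assumes "finite B"
    and len: "\<And>b. b \<in> B \<Longrightarrow> length b = L"
    and rot: "\<And>b r. b \<in> B \<Longrightarrow> rotate r b \<in> B"
    and val: "\<And>b. b \<in> B \<Longrightarrow> sum_list (map v b) = (-1 :: int)"
    and w: "\<And>b r. b \<in> B \<Longrightarrow> w (rotate r b) = w b"
  shows "sum w B = of_nat L * sum w {b \<in> B. proper_prefixes_nonneg (map v b)}"
proof -
  let ?good = "\<lambda>b. proper_prefixes_nonneg (map v b)"
  have bij: "bij_betw (rotate r) B B" for r
  proof -
    have "inj_on (rotate r) B"
      by (metis inj_fn inj_on_subset inj_rotate1 rotate_def subset_UNIV)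
    then show ?thesis
      using endo_inj_surj [OF \<open>finite B\<close>, of "rotate r"] rot by (auto simp: bij_betw_def)
  qed
  have one: "(\<Sum>r<L. if ?good (rotate r b) then w b else 0) = w b" if b: "b \<in> B" for b
  proof -
    obtain r where "r < L" and "\<And>q. q < L \<Longrightarrow> ?good (rotate q b) \<longleftrightarrow> q = r"
      using cycle_lemma [of "map v b"] val [OF b] len [OF b] by (auto simp: rotate_map)
    then have "(\<Sum>q<L. if ?good (rotate q b) then w b else 0) = (\<Sum>q<L. if q = r then w b else 0)"
      by (intro sum.cong) auto
    then show ?thesis using \<open>r < L\<close> by simp
  qed
  have "sum w B = (\<Sum>b\<in>B. \<Sum>r<L. if ?good (rotate r b) then w b else 0)"
    by (simp add: one)
  \<comment> \<open>By invariance of \<open>w\<close> the summand becomes a function of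
    \<open>rotate r b\<close> alone, ready for reindexing.\<close>
  also have "\<dots> = (\<Sum>r<L. \<Sum>b\<in>B. if ?good (rotate r b) then w (rotate r b) else 0)"
    by (subst sum.swap) (auto simp: w intro!: sum.cong)
  also have "\<dots> = (\<Sum>r<L. \<Sum>b\<in>B. if ?good b then w b else 0)"
    by (intro sum.cong refl sum.reindex_bij_betw [OF bij])
  also have "\<dots> = of_nat L * sum w {b \<in> B. ?good b}"
    using \<open>finite B\<close> by (simp add: sum.inter_filter)
  finally show ?thesis .
qed

section \<open>Unique decomposition of step sequences into blocks, and heights\<close>

primrec word :: "(nat \<times> bool) list \<Rightarrow> step list" where
  "word [] = []"
| "word (b # bs) = replicate (fst b) U @ (if snd b then D else H) # word bs"

definition rise :: "nat \<times> bool \<Rightarrow> int" where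
  "rise b = int (fst b) - of_bool (snd b)"

lemma replicate_eq_cancel:
  "replicate a x @ y # ys = replicate b x @ z # zs \<longleftrightarrow> a = b \<and> y = z \<and> ys = zs"
  if "x \<noteq> y" "x \<noteq> z"
proof (induction a arbitrary: b)
  case 0
  then show ?case using that by (cases b) auto
next
  case (Suc a)
  then show ?case using that by (cases b) auto
qed

lemma word_inject: "word bs = word cs \<longleftrightarrow> bs = cs"
proof (induction bs arbitrary: cs)
  case Nil
  then show ?case by (cases cs) auto
next
  case (Cons b bs)
  show ?case
    by (cases cs; cases b) (auto simp: replicate_eq_cancel Cons.IH prod_eq_iff split: if_splits)
qed

text \<open>The appended \<open>D\<close> closes the last block. A further step \<open>U\<close> in
  front lengthens the first block, whereas \<open>H\<close> or \<open>D\<close> forms a new block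
  without up-steps.\<close>

lemma ex_word: "\<exists>bs. P @ [D] = word bs"
proof (induction P)
  case Nil
  have "[] @ [D] = word [(0, True)]" by simp
  then show ?case by blast
next
  case (Cons s P)
  then obtain b bs where *: "P @ [D] = word (b # bs)"
    by (metis append_is_Nil_conv list.exhaust not_Cons_self2 word.simps(1))
  show ?case
  proof (cases s)
    case U
    with * have "(s # P) @ [D] = word ((Suc (fst b), snd b) # bs)" by simp
    then show ?thesis by blast
  next
    case H
    with * have "(s # P) @ [D] = word ((0, False) # b # bs)" by simp
    then show ?thesis by blast
  next
    case D
    with * have "(s # P) @ [D] = word ((0, True) # b # bs)" by simp
    then show ?thesis by blast
  qed
qed

lemma count_list_replicate_if: "count_list (replicate a x) y = (if x = y then a else 0)"
  by (induction a) auto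

lemma count_list_word:
  "count_list (word bs) U = sum_list (map fst bs)"
  "count_list (word bs) D = count_list (map snd bs) True"
  "count_list (word bs) H = count_list (map snd bs) False"
proof -
  show "count_list (word bs) U = sum_list (map fst bs)"
    by (induction bs) (auto simp: count_list_replicate_if)
  show "count_list (word bs) D = count_list (map snd bs) True"
    by (induction bs) (auto simp: count_list_replicate_if)
  show "count_list (word bs) H = count_list (map snd bs) False"
    by (induction bs) (auto simp: count_list_replicate_if)
qed

lemma sum_list_rise:
  "sum_list (map rise bs) = int (sum_list (map fst bs)) - int (count_list (map snd bs) True)"
  by (induction bs) (auto simp: rise_def)

definition height :: "step list \<Rightarrow> int" where
  "height P = int (count_list P U) - int (count_list P D)"

lemma endpoint_eq:
  "endpoint k P = (int (count_list P U + count_list P D + k * count_list P H), height P)"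
proof (induction P)
  case Nil
  then show ?case by (simp add: endpoint_def height_def zero_prod_def)
next
  case (Cons s P)
  then show ?case by (cases s) (auto simp: endpoint_def height_def algebra_simps)
qed

lemma height_append: "height (P @ Q) = height P + height Q"
  by (simp add: height_def)

text \<open>With strict bounds the prefix \<open>xs\<close> is covered once only, as
  \<open>xs @ take 0 ys\<close>.\<close>

lemma all_less_append:
  "(\<forall>l<length (xs @ ys). Q (take l (xs @ ys))) \<longleftrightarrow>
   (\<forall>l<length xs. Q (take l xs)) \<and> (\<forall>l<length ys. Q (xs @ take l ys))"
proof -
  have "Q (take l (xs @ ys))"
    if "\<forall>l<length xs. Q (take l xs)" "\<forall>l<length ys. Q (xs @ take l ys)" "l < length (xs @ ys)" for l
    using that by (cases "l < length xs") auto
  moreover have "Q (take l xs)" if "\<forall>l<length (xs @ ys). Q (take l (xs @ ys))" "l < length xs" for l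
    using that(1) [rule_format, of l] that(2) by simp
  moreover have "Q (xs @ take l ys)"
    if "\<forall>l<length (xs @ ys). Q (take l (xs @ ys))" "l < length ys" for l
    using that(1) [rule_format, of "length xs + l"] that(2) by simp
  ultimately show ?thesis by blast
qed

text \<open>The lowest points of a lattice path are the ends of blocks.\<close>

lemma prefixes_word:
  "(\<forall>l<length (word bs). 0 \<le> c + height (take l (word bs))) \<longleftrightarrow>
   (\<forall>l<length bs. 0 \<le> c + sum_list (take l (map rise bs)))"
\<comment> \<open>The initial height \<open>c\<close> varies because the remaining blocks start at
  height \<open>c + rise b\<close>.\<close>
proof (induction bs arbitrary: c)
  case Nil
  then show ?case by simp
next
  case (Cons b bs)
  define blk where "blk = replicate (fst b) U @ [if snd b then D else H]"
  have w: "word (b # bs) = blk @ word bs" by (simp add: blk_def)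
  have h: "height blk = rise b" by (simp add: blk_def height_def rise_def count_list_replicate_if)
  \<comment> \<open>Before its last step a block only climbs, so its proper prefixes are lowest at
    the start.\<close>
  have pre: "height (take l blk) = int l" if "l < length blk" for l
    using that by (simp add: blk_def height_def count_list_replicate_if)
  have first: "(\<forall>l<length blk. 0 \<le> c + height (take l blk)) \<longleftrightarrow> 0 \<le> c"
  proof
    assume "\<forall>l<length blk. 0 \<le> c + height (take l blk)"
    from this [rule_format, of 0] show "0 \<le> c" by (simp add: blk_def height_def)
  qed (simp add: pre)
  have "(\<forall>l<length (word (b # bs)). 0 \<le> c + height (take l (word (b # bs)))) \<longleftrightarrow>
      0 \<le> c \<and> (\<forall>l<length (word bs). 0 \<le> (c + rise b) + height (take l (word bs)))"
    unfolding w using all_less_append [of blk "word bs" "\<lambda>P. 0 \<le> c + height P"]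
    by (simp only: first height_append h add.assoc)
  also have "\<dots> \<longleftrightarrow> 0 \<le> c \<and> (\<forall>l<length bs. 0 \<le> (c + rise b) + sum_list (take l (map rise bs)))"
    by (simp only: Cons.IH)
  also have "\<dots> \<longleftrightarrow> (\<forall>l<length (b # bs). 0 \<le> c + sum_list (take l (map rise (b # bs))))"
    by (simp add: All_less_Suc2 add.assoc)
  finally show ?case .
qed

section \<open>Up-segments and weights of block sequences\<close>

lemma u_segment_at_snoc:
  assumes "s \<noteq> U"
  shows "u_segment_at (P @ [s]) a i \<longleftrightarrow> u_segment_at P a i"
proof (cases "1 \<le> i \<and> a + i \<le> Suc (length P)")
  case True
  show ?thesis
  proof (cases "a + i = Suc (length P)")
    case eq: True
    then have "length P \<in> {a..<a + i}" using True by auto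
    then show ?thesis
      using eq assms by (auto simp: u_segment_at_def intro!: bexI [of _ "length P"])
  next
    case False
    then have "(\<forall>l\<in>{a..<a + i}. (P @ [s]) ! l = U) \<longleftrightarrow> (\<forall>l\<in>{a..<a + i}. P ! l = U)"
      using True by (intro ball_cong) (auto simp: nth_append)
    then show ?thesis
      using True False assms by (auto simp: u_segment_at_def nth_append)
  qed
qed (auto simp: u_segment_at_def)

lemma alpha_snoc: "s \<noteq> U \<Longrightarrow> alpha i (P @ [s]) = alpha i P"
  by (simp add: alpha_def u_segment_at_snoc)

text \<open>A segment starting at or before position \<open>c\<close> can only be the whole initial
  run; those starting after the separator \<open>s\<close> are the segments of \<open>P\<close>,
  shifted by \<open>Suc c\<close>.\<close>

lemma alpha_block:
  assumes s: "s \<noteq> U" and i: "1 \<le> i"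
  shows "alpha i (replicate c U @ s # P) = of_bool (c = i) + alpha i P"
proof -
  let ?w = "replicate c U @ s # P"
  have nth1: "?w ! l = U" if "l < c" for l using that by (simp add: nth_append)
  have nth2: "?w ! c = s" by (simp add: nth_append)
  have nth3: "?w ! (Suc c + l) = P ! l" for l by (simp add: nth_append)
  have low: "u_segment_at ?w a i \<longleftrightarrow> a = 0 \<and> c = i" if "a \<le> c" for a
  proof
    assume A: "u_segment_at ?w a i"
    have "a = 0"
      using A nth1 [of "a - 1"] that by (cases a) (auto simp: u_segment_at_def)
    moreover have "\<not> i < c"
      using A nth1 [of i] \<open>a = 0\<close> by (auto simp: u_segment_at_def)
    moreover have "\<not> c < i"
      using A nth2 s \<open>a = 0\<close> by (auto simp: u_segment_at_def)
    ultimately show "a = 0 \<and> c = i" by simp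
  next
    assume "a = 0 \<and> c = i"
    then show "u_segment_at ?w a i"
      using nth1 nth2 s i by (auto simp: u_segment_at_def)
  qed
  have high: "u_segment_at ?w (Suc c + a) i \<longleftrightarrow> u_segment_at P a i" for a
  proof -
    have "(\<forall>l\<in>{Suc c + a..<Suc c + a + i}. ?w ! l = U) \<longleftrightarrow>
        (\<forall>l\<in>(+) (Suc c) ` {a..<a + i}. ?w ! l = U)"
      unfolding image_add_atLeastLessThan by (simp add: ac_simps)
    also have "\<dots> \<longleftrightarrow> (\<forall>l\<in>{a..<a + i}. P ! l = U)"
      by (simp only: ball_simps nth3)
    finally have mid: "(\<forall>l\<in>{Suc c + a..<Suc c + a + i}. ?w ! l = U) \<longleftrightarrow> (\<forall>l\<in>{a..<a + i}. P ! l = U)" .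
    \<comment> \<open>For \<open>a = 0\<close> the left neighbour is \<open>s\<close>, which bounds
      a run just as the start of \<open>P\<close> does.\<close>
    have left: "?w ! (Suc c + a - 1) = (if a = 0 then s else P ! (a - 1))"
      using nth2 nth3 [of "a - 1"] by auto
    show ?thesis
      unfolding u_segment_at_def mid left unfolding add.assoc nth3 using s by auto
  qed
  have "{a. u_segment_at ?w a i} = (if c = i then {0} else {}) \<union> (+) (Suc c) ` {a. u_segment_at P a i}"
    (is "?A = ?B")
  proof (rule set_eqI)
    fix a
    show "a \<in> ?A \<longleftrightarrow> a \<in> ?B"
    proof (cases "a \<le> c")
      case True
      then show ?thesis using low by auto
    next
      case False
      then obtain a' where a': "a = Suc c + a'" by (metis less_natE not_le add_Suc)
      then have "a \<in> ?B \<longleftrightarrow> u_segment_at P a' i" by auto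
      then show ?thesis using high [of a'] by (simp only: a' mem_Collect_eq)
    qed
  qed
  moreover have "finite {a. u_segment_at P a i}"
    by (rule finite_subset [of _ "{..length P}"]) (auto simp: u_segment_at_def)
  ultimately show ?thesis
    by (auto simp: alpha_def card_insert_if card_image inj_on_def)
qed

lemma alpha_word: "1 \<le> i \<Longrightarrow> alpha i (word bs) = count_list (map fst bs) i"
proof (induction bs)
  case Nil
  then show ?case by (simp add: alpha_def u_segment_at_def)
next
  case (Cons b bs)
  then show ?case by (simp add: alpha_block)
qed

text \<open>A block without up-steps contributes no \<open>u\<close>-segment, so the value at 0 is 1
  instead of the indeterminate \<open>t 0\<close>.\<close>

definition t0 :: "nat \<Rightarrow> qpoly" where
  "t0 i = (if i = 0 then 1 else t i)"

lemma u_weight_word: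
  assumes "word bs = P @ [D]"
  shows "u_weight P = (\<Prod>b\<leftarrow>bs. t0 (fst b))"
proof -
  \<comment> \<open>A bound for \<open>length P\<close> and for the up-steps of every block, which
    stays fixed while the induction takes \<open>bs\<close> apart.\<close>
  define M where "M = length P + sum_list (map fst bs)"
  have "u_weight P = (\<Prod>i = 1..M. t i ^ alpha i P)"
    unfolding u_weight_def
    by (rule prod.mono_neutral_left) (auto simp: M_def alpha_eq_0)
  also have "\<dots> = (\<Prod>i = 1..M. t i ^ count_list (map fst bs) i)"
    by (rule prod.cong) (use assms alpha_word [of _ bs] in \<open>auto simp: alpha_snoc\<close>)
  also have "\<dots> = (\<Prod>b\<leftarrow>bs. t0 (fst b))"
  proof -
    have "\<forall>b\<in>set bs. fst b \<le> M"
    proof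
      fix b assume "b \<in> set bs"
      then have "fst b \<in> set (map fst bs)" by simp
      from member_le_sum_list [OF this] show "fst b \<le> M" by (simp add: M_def)
    qed
    then show ?thesis
    proof (induction bs)
      case (Cons b bs)
      have "(\<Prod>i = 1..M. t i ^ count_list (map fst (b # bs)) i) =
          (\<Prod>i = 1..M. (if i = fst b then t i else 1) * t i ^ count_list (map fst bs) i)"
        by (intro prod.cong) auto
      also have "\<dots> = t0 (fst b) * (\<Prod>i = 1..M. t i ^ count_list (map fst bs) i)"
        using Cons.prems by (auto simp: prod.distrib t0_def)
      finally show ?case using Cons by simp
    qed simp
  qed
  finally show ?thesis .
qed


section \<open>Compositions and partial Bell polynomials\<close>

lemma const_mult: "const (a * b) = const a * const b"
  by (simp add: const_def mult_single)

lemma const_1: "const 1 = 1"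
  by (simp add: const_def)

lemma of_nat_qpoly: "(of_nat a :: qpoly) = const (of_nat a)"
  by (induction a) (simp_all add: const_def single_add)

lemma size_eq_sum_count:
  "finite S \<Longrightarrow> set_mset A \<subseteq> S \<Longrightarrow> size A = (\<Sum>x\<in>S. count A x)"
  unfolding size_multiset_overloaded_eq
  by (rule sum.mono_neutral_left) (auto simp: count_eq_zero_iff)

lemma sum_mset_eq_sum_count:
  fixes A :: "nat multiset"
  assumes "finite S"
  shows "set_mset A \<subseteq> S \<Longrightarrow> sum_mset A = (\<Sum>x\<in>S. x * count A x)"
proof (induction A)
  case (add x A)
  have "(\<Sum>y\<in>S. y * count (add_mset x A) y) = (\<Sum>y\<in>S. (if y = x then y else 0) + y * count A y)"
    by (intro sum.cong) auto
  also have "\<dots> = x + (\<Sum>y\<in>S. y * count A y)"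
    using add.prems \<open>finite S\<close> by (simp add: sum.distrib)
  finally show ?case using add by simp
qed simp

lemma prod_count_mono_neutral:
  assumes "finite S" "set_mset A \<subseteq> S" "\<And>x. f x 0 = 1"
  shows "(\<Prod>x\<in>set_mset A. f x (count A x)) = (\<Prod>x\<in>S. f x (count A x))"
  using assms by (intro prod.mono_neutral_left) (auto simp: not_in_iff)

text \<open>Lists are grouped by their multiset of entries; the multiplicities of the positive entries form
  a solution \<open>\<rho>\<close>, and \<open>0\<close> fills the remaining \<open>L - r\<close> places.\<close>

lemma sum_compositions:
  assumes "m \<le> L"
  shows "(\<Sum>as\<in>{as. length as = L \<and> sum_list as = m}. \<Prod>a\<leftarrow>as. t0 a) =
    (\<Sum>r = 0..m. \<Sum>\<rho>\<in>bell_solutions m r.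
      const (of_nat (L choose r) * fact r / (\<Prod>i = 1..m. fact (\<rho> i))) * (\<Prod>i = 1..m. t i ^ \<rho> i))"
    (is "sum _ ?X = _")
proof -
  define C where "C = {A. size A = L \<and> sum_mset A = m}"
  \<comment> \<open>The joint contribution of all arrangements of \<open>A\<close>; zeros affect
    only their number.\<close>
  define W where "W A = of_nat (card (permutations_of_multiset A)) * (\<Prod>i = 1..m. t i ^ count A i)"
    for A :: "nat multiset"
  have sub: "set_mset A \<subseteq> insert 0 {1..m}" if "A \<in> C" for A
    using that by (auto simp: C_def dest!: multi_member_split)
  have "?X \<subseteq> {as. set as \<subseteq> {..m} \<and> length as = L}"
    using member_le_sum_list by auto
  then have fin: "finite ?X"
    by (rule finite_subset) (simp add: finite_lists_length_eq)
  have img: "mset ` ?X = C"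
  proof
    show "mset ` ?X \<subseteq> C" by (auto simp: C_def sum_mset_sum_list)
    show "C \<subseteq> mset ` ?X"
    proof
      fix A assume "A \<in> C"
      moreover obtain as where "mset as = A" using ex_mset by blast
      ultimately show "A \<in> mset ` ?X" by (auto simp: C_def sum_mset_sum_list)
    qed
  qed
  have "(\<Sum>as\<in>?X. \<Prod>a\<leftarrow>as. t0 a) = (\<Sum>A\<in>C. \<Sum>as\<in>{as \<in> ?X. mset as = A}. \<Prod>a\<leftarrow>as. t0 a)"
    using fin img by (intro sum.group [symmetric]) auto
  also have "\<dots> = (\<Sum>A\<in>C. W A)"
  proof (rule sum.cong [OF refl])
    fix A assume A: "A \<in> C"
    then have "{as \<in> ?X. mset as = A} = permutations_of_multiset A"
      by (auto simp: permutations_of_multiset_def C_def sum_mset_sum_list)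
    moreover have "(\<Prod>a\<leftarrow>as. t0 a) = (\<Prod>i = 1..m. t i ^ count A i)"
      if "as \<in> permutations_of_multiset A" for as
    proof -
      have "(\<Prod>a\<leftarrow>as. t0 a) = prod_mset (image_mset t0 A)"
        using that by (simp add: permutations_of_multiset_def flip: prod_mset_prod_list)
      also have "\<dots> = (\<Prod>i\<in>insert 0 {1..m}. t0 i ^ count A i)"
        using sub [OF A] by (simp only: image_prod_mset_multiplicity finite.intros finite_atLeastAtMost power_0
            prod_count_mono_neutral [of "insert 0 {1..m}" A "\<lambda>x e. t0 x ^ e"])
      also have "\<dots> = (\<Prod>i = 1..m. t i ^ count A i)"
        by (simp add: t0_def)
      finally show ?thesis .
    qed
    ultimately show "(\<Sum>as\<in>{as \<in> ?X. mset as = A}. \<Prod>a\<leftarrow>as. t0 a) = W A"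
      by (simp add: W_def)
  qed
  also have "\<dots> = (\<Sum>(r, \<rho>)\<in>Sigma {0..m} (bell_solutions m).
      const (of_nat (L choose r) * fact r / (\<Prod>i = 1..m. fact (\<rho> i))) * (\<Prod>i = 1..m. t i ^ \<rho> i))"
  proof (rule sum.reindex_bij_witness [of _
        "\<lambda>(r, \<rho>). (\<Sum>i = 1..m. replicate_mset (\<rho> i) i) + replicate_mset (L - r) 0"
        "\<lambda>A. (L - count A 0, \<lambda>i. if i \<in> {1..m} then count A i else 0)"])
    fix A assume A: "A \<in> C"
    have sz: "count A 0 + (\<Sum>i = 1..m. count A i) = L"
      using A size_eq_sum_count [OF _ sub [OF A]] by (simp add: C_def)
    have sm: "(\<Sum>i = 1..m. i * count A i) = m"
      using A sum_mset_eq_sum_count [OF _ sub [OF A]] by (simp add: C_def)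
    \<comment> \<open>Every positive part is at least 1, so there are at most \<open>m\<close> of
      them.\<close>
    have "(\<Sum>i = 1..m. count A i) \<le> (\<Sum>i = 1..m. i * count A i)"
      by (intro sum_mono) auto
    then have r: "L - count A 0 \<le> m" using sz sm by simp
    have c0: "count A 0 \<le> L" using sz by simp
    show "(case (L - count A 0, \<lambda>i. if i \<in> {1..m} then count A i else 0) of
        (r, \<rho>) \<Rightarrow> (\<Sum>i = 1..m. replicate_mset (\<rho> i) i) + replicate_mset (L - r) 0) = A"
    proof (rule multiset_eqI)
      fix x
      have "count A x = 0" if "x > m"
        using sub [OF A] that by (auto simp: count_eq_zero_iff)
      then show "count (case (L - count A 0, \<lambda>i. if i \<in> {1..m} then count A i else 0) of
          (r, \<rho>) \<Rightarrow> (\<Sum>i = 1..m. replicate_mset (\<rho> i) i) + replicate_mset (L - r) 0) x = count A x"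
        using c0 by (cases "x = 0") (auto simp: count_sum not_le)
    qed
    show "(L - count A 0, \<lambda>i. if i \<in> {1..m} then count A i else 0) \<in> Sigma {0..m} (bell_solutions m)"
      using r sz sm by (auto simp: bell_solutions_def)
    let ?p = "\<Prod>i = 1..m. fact (count A i) :: rat"
    have "?p \<noteq> 0" by simp
    \<comment> \<open>The number of arrangements is a multinomial coefficient. Cancelling the
      factorial for the zeros leaves \<open>L choose r\<close> times \<open>fact r\<close>, divided
      by the factorials of the positive parts' multiplicities, where
      \<open>r = L - count A 0\<close>.\<close>
    have "(\<Prod>x\<in>set_mset A. fact (count A x)) = (fact (count A 0) * (\<Prod>i = 1..m. fact (count A i)) :: nat)"
      by (subst prod_count_mono_neutral [OF _ sub [OF A]]) simp_all
    then have "card (permutations_of_multiset A) * (fact (count A 0) * (\<Prod>i = 1..m. fact (count A i))) = fact L"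
      using card_permutations_of_multiset_aux [of A] A by (simp only: C_def mem_Collect_eq)
    from arg_cong [OF this, of "of_nat :: nat \<Rightarrow> rat"]
    have "of_nat (card (permutations_of_multiset A)) * (fact (count A 0) * ?p) = fact L"
      by simp
    moreover have "fact (L - count A 0) * fact (count A 0) * of_nat (L choose (L - count A 0)) = (fact L :: rat)"
      using binomial_fact_lemma [of "L - count A 0" L] c0
      by (metis diff_diff_cancel diff_le_self of_nat_fact of_nat_mult)
    ultimately have "(fact (count A 0) :: rat) * (of_nat (card (permutations_of_multiset A)) * ?p) =
        fact (count A 0) * (of_nat (L choose (L - count A 0)) * fact (L - count A 0))"
      by (simp only: ac_simps)
    then have "of_nat (card (permutations_of_multiset A)) * ?p =
        of_nat (L choose (L - count A 0)) * fact (L - count A 0)"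
      by (simp only: mult_left_cancel fact_nonzero not_False_eq_True)
    then have "(of_nat (card (permutations_of_multiset A)) :: rat) =
        of_nat (L choose (L - count A 0)) * fact (L - count A 0) / ?p"
      by (simp only: nonzero_eq_divide_eq [OF \<open>?p \<noteq> 0\<close>])
    then show "(case (L - count A 0, \<lambda>i. if i \<in> {1..m} then count A i else 0) of
        (r, \<rho>) \<Rightarrow> const (of_nat (L choose r) * fact r / (\<Prod>i = 1..m. fact (\<rho> i))) *
          (\<Prod>i = 1..m. t i ^ \<rho> i)) = W A"
      by (simp add: W_def of_nat_qpoly)
  next
    fix x assume "x \<in> Sigma {0..m} (bell_solutions m)"
    then obtain r \<rho> where x: "x = (r, \<rho>)" "r \<le> m" "\<rho> \<in> bell_solutions m r" by auto
    define A where "A = (\<Sum>i = 1..m. replicate_mset (\<rho> i) i) + replicate_mset (L - r) 0"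
    have cnt: "count A i = (if i = 0 then L - r else \<rho> i)" for i
      using x(3) by (auto simp: A_def count_sum bell_solutions_def)
    have subA: "set_mset A \<subseteq> insert 0 {1..m}"
    proof
      fix i assume "i \<in># A"
      then have "count A i \<noteq> 0" by simp
      then show "i \<in> insert 0 {1..m}"
        using cnt [of i] x(3) by (auto simp: bell_solutions_def split: if_splits simp del: count_eq_zero_iff)
    qed
    \<comment> \<open>Since \<open>r \<le> m\<close> and \<open>m \<le> L\<close>, the subtraction
      \<open>L - r\<close> is not truncated.\<close>
    have size: "size A = L"
      using size_eq_sum_count [OF _ subA] x assms by (simp add: cnt bell_solutions_def)
    have sum: "sum_mset A = m"
      using sum_mset_eq_sum_count [OF _ subA] x by (simp add: cnt bell_solutions_def)
    have "(L - count A 0, \<lambda>i. if i \<in> {1..m} then count A i else 0) = x"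
      using x assms cnt by (auto simp: bell_solutions_def fun_eq_iff)
    then show "(case case x of (r, \<rho>) \<Rightarrow> (\<Sum>i = 1..m. replicate_mset (\<rho> i) i) + replicate_mset (L - r) 0 of
        A \<Rightarrow> (L - count A 0, \<lambda>i. if i \<in> {1..m} then count A i else 0)) = x"
      by (simp only: x(1) prod.case A_def)
    show "(case x of (r, \<rho>) \<Rightarrow> (\<Sum>i = 1..m. replicate_mset (\<rho> i) i) + replicate_mset (L - r) 0) \<in> C"
      using size sum by (simp only: x(1) prod.case A_def C_def mem_Collect_eq simp_thms)
  qed
  also have "\<dots> = (\<Sum>r = 0..m. \<Sum>\<rho>\<in>bell_solutions m r.
      const (of_nat (L choose r) * fact r / (\<Prod>i = 1..m. fact (\<rho> i))) * (\<Prod>i = 1..m. t i ^ \<rho> i))"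
    by (rule sum.Sigma [symmetric]) (auto simp: finite_bell_solutions)
  finally show ?thesis .
qed

section \<open>Block sequences without the positivity condition\<close>

lemma length_bool_list: "length ss = count_list ss True + count_list ss False"
  by (induction ss) auto

text \<open>These lists are the arrangements of a multiset with \<open>a\<close> copies of
  \<open>True\<close> and \<open>b\<close> of \<open>False\<close>.\<close>

lemma card_bool_lists:
  "card {ss. length ss = a + b \<and> count_list ss True = a} = (a + b) choose a"
proof -
  let ?A = "replicate_mset a True + replicate_mset b False"
  have "{ss. length ss = a + b \<and> count_list ss True = a} = permutations_of_multiset ?A"
    by (auto simp: permutations_of_multiset_def length_bool_list multiset_eq_iff count_mset split: bool.splits)
  moreover have "(\<Prod>x\<in>set_mset ?A. fact (count ?A x)) = (fact a * fact b :: nat)"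
    by (subst prod_count_mono_neutral [of UNIV]) (simp_all add: UNIV_bool)
  then have "card (permutations_of_multiset ?A) * (fact a * fact b) = fact (a + b)"
    using card_permutations_of_multiset_aux [of ?A] by (simp only: size_union size_replicate_mset)
  moreover have "((a + b) choose a) * (fact a * fact b) = fact (a + b)"
    using binomial_fact_lemma [of a "a + b"] by (simp add: mult.commute)
  ultimately show ?thesis
    by (metis fact_nonzero mult_eq_0_iff mult_right_cancel)
qed

text \<open>The count \<open>m + 1\<close> includes the appended down-step, which makes the total
  rise \<open>-1\<close>.\<close>

definition blocks :: "nat \<Rightarrow> nat \<Rightarrow> (nat \<times> bool) list set" where
  "blocks m j = {bs. length bs = m + j + 1 \<and> sum_list (map fst bs) = m \<and>
     count_list (map snd bs) True = m + 1}"

text \<open>Zipping identifies block sequences with pairs of independently chosen lists of equal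
  length, and the summand ignores the second list.\<close>

lemma sum_blocks:
  "(\<Sum>bs\<in>blocks m j. \<Prod>b\<leftarrow>bs. f (fst b)) =
   of_nat ((m + j + 1) choose (m + 1)) *
     (\<Sum>as\<in>{as. length as = m + j + 1 \<and> sum_list as = m}. \<Prod>a\<leftarrow>as. f a :: 'a::comm_semiring_1)"
proof -
  let ?X = "{as. length as = m + j + 1 \<and> sum_list as = m}"
  let ?Y = "{ss. length ss = m + j + 1 \<and> count_list ss True = m + 1}"
  have "(\<Sum>bs\<in>blocks m j. \<Prod>b\<leftarrow>bs. f (fst b)) = (\<Sum>(as, ss)\<in>?X \<times> ?Y. \<Prod>a\<leftarrow>as. f a)"
    by (rule sum.reindex_bij_witness [of _ "\<lambda>(as, ss). zip as ss" "\<lambda>bs. (map fst bs, map snd bs)"])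
      (auto simp: blocks_def zip_map_fst_snd o_def)
  also have "\<dots> = (\<Sum>as\<in>?X. \<Sum>ss\<in>?Y. \<Prod>a\<leftarrow>as. f a)"
    by (rule sum.cartesian_product [symmetric])
  also have "\<dots> = of_nat (card ?Y) * (\<Sum>as\<in>?X. \<Prod>a\<leftarrow>as. f a)"
    by (simp add: sum_distrib_left)
  also have "card ?Y = (m + j + 1) choose (m + 1)"
    using card_bool_lists [of "m + 1" j] by (simp add: ac_simps)
  finally show ?thesis .
qed

lemma finite_blocks: "finite (blocks m j)"
proof (rule finite_subset)
  have "fst b \<le> m" if "bs \<in> blocks m j" "b \<in> set bs" for b bs
    using that member_le_sum_list [of "fst b" "map fst bs"] by (auto simp: blocks_def)
  then show "blocks m j \<subseteq> {bs. set bs \<subseteq> {..m} \<times> UNIV \<and> length bs = m + j + 1}"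
    by (fastforce simp: blocks_def)
qed (simp add: finite_lists_length_eq)

lemma mset_rotate: "mset (rotate n xs) = mset xs"
  by (metis append_take_drop_id mset_append rotate_drop_take union_commute)

lemma rotate_blocks: "bs \<in> blocks m j \<Longrightarrow> rotate r bs \<in> blocks m j"
  by (simp add: blocks_def rotate_map [symmetric] mset_rotate
      flip: sum_mset_sum_list count_mset)

lemma sum_list_rise_blocks: "bs \<in> blocks m j \<Longrightarrow> sum_list (map rise bs) = -1"
  by (simp add: blocks_def sum_list_rise)

section \<open>Correspondence between paths and good block sequences\<close>

lemma word_append: "word (bs @ cs) = word bs @ word cs"
  by (induction bs) auto

text \<open>The blocks before the last have nonnegative total rise, so the last one has negative
  rise and cannot end in \<open>H\<close>.\<close>

lemma word_ends_with_D:
  assumes "sum_list (map rise bs) = -1" "proper_prefixes_nonneg (map rise bs)"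
  shows "\<exists>P. word bs = P @ [D]"
proof -
  obtain cs b where bs: "bs = cs @ [b]"
    using assms(1) by (cases bs rule: rev_cases) auto
  have "0 \<le> sum_list (map rise cs)"
    using assms(2) [unfolded proper_prefixes_nonneg_def, rule_format, of "length cs"] by (simp add: bs)
  then have "snd b" using assms(1) by (cases "snd b") (auto simp: bs rise_def)
  then have "word bs = (word cs @ replicate (fst b) U) @ [D]"
    by (simp add: bs word_append)
  then show ?thesis by blast
qed

text \<open>Once the three step counts are right, the endpoint condition follows from the formula
  for \<open>n\<close>, and the convention for \<open>k = 0\<close> from \<open>j = 0\<close>. Only
  nonnegativity remains to be translated.\<close>

lemma kpaths_iff_blocks:
  assumes "n = 2 * m + k * j" "k = 0 \<longrightarrow> j = 0" and w: "word bs = P @ [D]"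
  shows "P \<in> kpaths n k m j \<longleftrightarrow> bs \<in> blocks m j \<and> proper_prefixes_nonneg (map rise bs)"
proof -
  have c: "count_list P U = sum_list (map fst bs)"
    "count_list P D + 1 = count_list (map snd bs) True"
    "count_list P H = count_list (map snd bs) False"
    using count_list_word [of bs] w by simp_all
  have "height P = 0 \<longleftrightarrow> count_list P U = count_list P D"
    by (simp add: height_def)
  then have "is_kpath k n P \<longleftrightarrow>
      count_list P U + count_list P D + k * count_list P H = n \<and> count_list P U = count_list P D \<and>
      (\<forall>l\<le>length P. 0 \<le> height (take l P)) \<and> (k = 0 \<longrightarrow> count_list P H = 0)"
    by (simp only: is_kpath_def endpoint_eq prod.inject of_nat_eq_iff snd_conv count_list_0_iff conj_assoc)
  moreover have "2 * m + k * j = m + m + k * j" by simp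
  ultimately have kpath: "P \<in> kpaths n k m j \<longleftrightarrow>
      count_list P U = m \<and> count_list P D = m \<and> count_list P H = j \<and>
      (\<forall>l\<le>length P. 0 \<le> height (take l P))"
    unfolding kpaths_def mem_Collect_eq using assms(1,2) by metis
  have blocks: "bs \<in> blocks m j \<longleftrightarrow> count_list P U = m \<and> count_list P D = m \<and> count_list P H = j"
    using length_bool_list [of "map snd bs"] c by (auto simp: blocks_def)
  \<comment> \<open>The prefixes of \<open>P\<close>, including \<open>P\<close> itself, are the
    proper prefixes of \<open>P @ [D]\<close>.\<close>
  have "(\<forall>l\<le>length P. 0 \<le> height (take l P)) \<longleftrightarrow> proper_prefixes_nonneg (map rise bs)"
    using prefixes_word [of bs 0] by (simp add: w proper_prefixes_nonneg_def less_Suc_eq_le)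
  then show ?thesis unfolding kpath blocks by blast
qed

text \<open>Deleting the final \<open>D\<close> from the word of a good block sequence is a
  weight-preserving bijection onto the paths.\<close>

lemma sum_kpaths:
  assumes "n = 2 * m + k * j" "k = 0 \<longrightarrow> j = 0"
  shows "(\<Sum>P\<in>kpaths n k m j. u_weight P) =
    (\<Sum>bs\<in>{bs \<in> blocks m j. proper_prefixes_nonneg (map rise bs)}. \<Prod>b\<leftarrow>bs. t0 (fst b))"
    (is "_ = sum _ ?G")
proof (rule sum.reindex_cong)
  have ends: "word bs = butlast (word bs) @ [D]" if bs: "bs \<in> ?G" for bs
  proof -
    obtain P where "word bs = P @ [D]"
      using bs word_ends_with_D [of bs] sum_list_rise_blocks [of bs m j] by auto
    then show ?thesis by simp
  qed
  show "inj_on (\<lambda>bs. butlast (word bs)) ?G"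
  proof (rule inj_onI)
    fix bs cs assume "bs \<in> ?G" "cs \<in> ?G" "butlast (word bs) = butlast (word cs)"
    then have "word bs = word cs" using ends [of bs] ends [of cs] by argo
    then show "bs = cs" by (simp add: word_inject)
  qed
  show "u_weight (butlast (word bs)) = (\<Prod>b\<leftarrow>bs. t0 (fst b))" if "bs \<in> ?G" for bs
    using ends [OF that] by (rule u_weight_word)
  show "kpaths n k m j = (\<lambda>bs. butlast (word bs)) ` ?G"
  proof
    show "(\<lambda>bs. butlast (word bs)) ` ?G \<subseteq> kpaths n k m j"
    proof (rule image_subsetI)
      fix bs assume "bs \<in> ?G"
      then show "butlast (word bs) \<in> kpaths n k m j"
        using kpaths_iff_blocks [OF assms ends] by simp
    qed
    show "kpaths n k m j \<subseteq> (\<lambda>bs. butlast (word bs)) ` ?G"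
    proof
      fix P assume "P \<in> kpaths n k m j"
      obtain bs where bs: "word bs = P @ [D]" using ex_word [of P] by auto
      have "bs \<in> ?G" using kpaths_iff_blocks [OF assms bs] \<open>P \<in> kpaths n k m j\<close> by simp
      with bs show "P \<in> (\<lambda>bs. butlast (word bs)) ` ?G" by (auto intro!: image_eqI [of _ _ bs])
    qed
  qed
qed

theorem theorem2p2:
  fixes n m k j :: nat
  assumes "n \<ge> 1" and "m \<ge> 1"
    and "n = 2 * m + k * j"
    and "k = 0 \<Longrightarrow> j = 0"
  shows "(\<Sum>P\<in>kpaths n k m j. u_weight P) =
    const (1 / of_nat (m + 1) * of_nat ((m + j) choose m)) *
      (\<Sum>r = 0..m. const (of_nat ((m + j + 1) choose r) * (fact r / fact m)) *
        bell_partial m r (\<lambda>i. const (fact i) * t i))"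
proof -
  define L where "L = m + j + 1"
  have kj: "k = 0 \<longrightarrow> j = 0" using assms(4) by blast
  let ?paths = "\<Sum>P\<in>kpaths n k m j. u_weight P"
  let ?comps = "\<Sum>as\<in>{as. length as = L \<and> sum_list as = m}. \<Prod>a\<leftarrow>as. t0 a"
  \<comment> \<open>The weight is a product over the blocks, hence invariant under rotation, and the
    weighted cycle lemma applies.\<close>
  have "of_nat L * ?paths = (\<Sum>bs\<in>blocks m j. \<Prod>b\<leftarrow>bs. t0 (fst b))"
    unfolding sum_kpaths [OF assms(3) kj]
  proof (rule sum_cycle_lemma [symmetric])
    show "(\<Prod>b\<leftarrow>rotate r bs. t0 (fst b)) = (\<Prod>b\<leftarrow>bs. t0 (fst b))" for r bs
      by (simp add: mset_rotate flip: prod_mset_prod_list)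
  qed (auto simp: finite_blocks rotate_blocks sum_list_rise_blocks, simp add: blocks_def L_def)
  also have "\<dots> = of_nat (L choose (m + 1)) * ?comps"
    by (simp add: sum_blocks L_def)
  finally have cycle: "const (of_nat L) * ?paths = const (of_nat (L choose (m + 1))) * ?comps"
    by (simp only: of_nat_qpoly)
  have inv: "const (1 / of_nat L) * const (of_nat L) = 1"
    by (simp add: L_def const_1 flip: const_mult)
  have "(of_nat L :: rat) \<noteq> 0" "(of_nat (m + 1) :: rat) \<noteq> 0"
    unfolding of_nat_eq_0_iff by (simp_all add: L_def)
  \<comment> \<open>The absorption identity turns the factor \<open>L choose (m + 1)\<close> over
    \<open>L\<close> into \<open>(m + j) choose m\<close> over \<open>m + 1\<close>.\<close>
  moreover have "of_nat (L choose (m + 1)) * of_nat (m + 1) = (of_nat L * of_nat ((m + j) choose m) :: rat)"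
    using arg_cong [OF Suc_times_binomial_eq [of "m + j" m], of "of_nat :: nat \<Rightarrow> rat"]
    by (simp only: L_def of_nat_mult Suc_eq_plus1)
  ultimately have ratio: "1 / of_nat L * of_nat (L choose (m + 1)) =
      (1 / of_nat (m + 1) * of_nat ((m + j) choose m) :: rat)"
    by (simp only: mult_1_left mult_1_right times_divide_eq_left times_divide_eq_right frac_eq_eq mult.commute simp_thms)
  have "?paths = const (1 / of_nat L) * (const (of_nat L) * ?paths)"
    by (simp only: inv mult.assoc [symmetric] mult_1_left)
  also have "\<dots> = const (1 / of_nat L * of_nat (L choose (m + 1))) * ?comps"
    by (simp only: cycle const_mult mult.assoc)
  finally have "?paths = const (1 / of_nat (m + 1) * of_nat ((m + j) choose m)) * ?comps"
    by (simp only: ratio)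
  also have "?comps = (\<Sum>r = 0..m. const (of_nat (L choose r) * (fact r / fact m)) *
        bell_partial m r (\<lambda>i. const (fact i) * t i))"
  proof -
    \<comment> \<open>The factorials in the arguments cancel the denominators built into the Bell
      polynomial, leaving plain monomials.\<close>
    have *: "const (1 / fact i) * (const (fact i) * t i) = t i" for i
      by (simp add: const_1 flip: const_mult mult.assoc)
    have "const (of_nat (L choose r) * (fact r / fact m)) * bell_partial m r (\<lambda>i. const (fact i) * t i) =
        (\<Sum>\<rho>\<in>bell_solutions m r. const (of_nat (L choose r) * fact r / (\<Prod>i = 1..m. fact (\<rho> i))) *
          (\<Prod>i = 1..m. t i ^ \<rho> i))" for r
      by (simp add: bell_partial_def * const_1 sum_distrib_left flip: const_mult mult.assoc)
    then show ?thesis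
      by (simp add: sum_compositions L_def)
  qed
  finally show ?thesis by (simp add: L_def)
qed

end
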